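(* Let $G$ and $H$ be graphs with $V(G)=[g]$ and $V(H)=[h]$. Then: (i) $\iota_L\,\mathrm{Hom}_+^t(G,H)=\iota_L\,\mathrm{Hom}_+(G,H)=\mathrm{Hom}(G,H)\times\tfrac{\mathbf 1}{g}$. In particular, all these complexes are canonically embedded in the same Euclidean space $\mathbb R^{gh}\times\mathbb R^g$. (ii) Sending each face $\sigma$ of $\mathrm{Hom}_+(G,H)$ through the maps $$\mathrm{Hom}_+(G,H)\xrightarrow{\ \iota_L\ }\mathrm{Hom}(G,H)\times\tfrac{\mathbf 1}{g}\xrightarrow{\ \pi_\Box\ }\pi_\Box\big(\mathrm{Hom}(G,H)\times\tfrac{\mathbf 1}{g}\big)$$ gives the same result as sending it through $$\mathrm{Hom}_+(G,H)\xrightarrow{\ \pi_\Box\ }\pi_\Box\mathrm{Hom}_+(G,H)\xrightarrow{\ \iota_{\pi_\Box(L)}\ }\pi_\Box\big(\mathrm{Hom}(G,H)\times\tfrac{\mathbf 1}{g}\big),$$ that is, the square formed by these four maps is well defined and commutes; moreover $\mathrm{Hom}_+(G,H)\subset \star_{x\in V(G)}\Delta_{V(H)}$, $\mathrm{Hom}(G,H)\times\frac{\mathbf 1}{g}\subset\Delta_{V(G)\times V(H)}\times\frac{\mathbf 1}{g}$, $\pi_\Box\mathrm{Hom}_+(G,H)\subset\Delta_{V(H)}\times\Delta_{V(G)}$ and $\pi_\Box(\mathrm{Hom}(G,H)\times\frac{\mathbf 1}{g})\subset\Delta_{V(H)}\times\frac{\mathbf 1}{g}$. In particular, the image $\pi_\Box(\sigma)$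 of any face $\sigma$ of $\mathrm{Hom}_+(G,H)$ is the convex hull of some vertices of $\Delta_{V(H)}\times\Delta_{V(G)}$, and $$\pi_\Box\big(\mathrm{Hom}(G,H)\times\tfrac{\mathbf 1}{g}\big)=\iota_{\pi_\Box(L)}\,\pi_\Box\mathrm{Hom}_+(G,H).$$ (iii) The statements in (ii) also hold with $\mathrm{Hom}_+(G,H)$ replaced by $\mathrm{Hom}_+^t(G,H)$.
   Context: Graphs are finite and undirected. For a finite set $B$, $\Delta_B=\mathrm{conv}\{e_i:i\in B\}\subset\mathbb R^{|B|}$; a subset of $B$ is identified with the face of $\Delta_B$ it spans (the empty set being the empty face). For $1\le i\le g$, $\mu_i:\mathbb R^h\hookrightarrow\mathbb R^{gh}=\mathbb R^h\times\dots\times\mathbb R^h$ is the inclusion as the $i$-th block. The join $\star_{x\in V(G)}\Delta_{V(H)}$ of $g$ labelled copies of $\Delta_{V(H)}$ is realized as the $(gh-1)$-simplex $\mathrm{conv}\bigcup_{i=1}^g\mu_i(\Delta_{V(H)})\times e_i\subset\mathbb R^{gh}\times\mathbb R^g$; its faces are $\star_{i}\sigma_i=\mathrm{conv}\bigcup_{i=1}^g\mu_i(\sigma_i)\times e_i$ with $\sigma_i\subset V(H)$ (possibly empty). $\mathrm{Hom}(G,H)$ is the polytopal complex of all cells $\times_{x\in V(G)}\sigma_x$ (all $\sigma_x\subset V(H)$ nonempty) of $\times_{x\in V(G)}\Delta_{V(H)}$ such that if $(x,y)\in E(G)$ then $(\sigma_x,\sigma_y)$ is a complete bipartite subgraph of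 $H$, i.e. every pair $(u,v)\in\sigma_x\times\sigma_y$ is an edge of $H$ (not required to be induced). It is realized in $\mathbb R^{gh}$ with the cell $\times_x\sigma_x$ realized as $\frac1g\big(\mu_1(\sigma_1)\times\dots\times\mu_g(\sigma_g)\big)=\frac1g\sum_i\mu_i(\sigma_i)$. $\mathrm{Hom}_+(G,H)$ is the simplicial subcomplex of $\star_{x\in V(G)}\Delta_{V(H)}$ of all simplices $\star_x\sigma_x$ such that if $(x,y)\in E(G)$ and both $\sigma_x,\sigma_y$ are nonempty, then $(\sigma_x,\sigma_y)$ is a complete bipartite subgraph of $H$. A face $\star_x\sigma_x$ is transversal if $|\sigma_x|>0$ for all $x\in V(G)$; $\mathrm{Hom}_+^t(G,H)$ is the subcomplex of $\mathrm{Hom}_+(G,H)$ induced by (i.e. consisting of all faces of) its transversal faces. $\frac{\mathbf 1}{g}=(\frac1g,\dots,\frac1g)\in\mathbb R^g$; $L=\mathbb R^{gh}\times\frac{\mathbf 1}{g}$. For an affine subspace $K$, $\iota_K$ denotes intersection with $K$, applied cell by cell to a family of polytopes (discarding empty intersections). $\pi_\Box:\mathbb R^{gh}\times\mathbb R^g\to\mathbb R^h\times\mathbb R^g$ is the linear map $(x_1,\dots,x_g,y)\mapsto(x_1+\dots+x_g,y)$ with $x_i\in\mathbb R^h$, $y\in\mathbb R^g$; applied to a family of polytopes it denotes the family of images. Thus $\pi_\Box(L)=\mathbb R^h\times\frac{\mathbf 1}{g}$. *)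

theory Defs
  imports "HOL-Analysis.Analysis"
begin

text \<open>
  A graph with vertex set \<open>[n]\<close> is a symmetric relation on a finite type of cardinality \<open>n\<close>
  (loops are permitted).  The space $\mathbb{R}^{gh} = \mathbb{R}^h \times \dots \times \mathbb{R}^h$
  is \<open>real ^ 'h ^ 'g\<close>, so that the inclusion $\mu_i$ of the \<open>i\<close>-th block is \<open>axis i\<close>.
  Families of polytopes are sets of subsets of the ambient space.
\<close>

definition std_simplex :: "'n set \<Rightarrow> (real ^ 'n::finite) set" where
  "std_simplex B = convex hull ((\<lambda>i. axis i 1) ` B)"

text \<open>The vertex of \<open>block_simplex\<close> with index \<open>(x, u)\<close> is $\mu_x(e_u)$.\<close>

definition block_simplex :: "(real ^ 'h::finite ^ 'g::finite) set" where
  "block_simplex = convex hull (range (\<lambda>(x, u). axis x (axis u 1)))"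

text \<open>A tuple \<open>\<sigma>\<close> of vertex sets stands for the face or cell it labels.\<close>

definition join_face :: "('g::finite \<Rightarrow> 'h::finite set) \<Rightarrow> ((real ^ 'h ^ 'g) \<times> (real ^ 'g)) set" where
  "join_face \<sigma> = convex hull (\<Union>i. (axis i ` std_simplex (\<sigma> i)) \<times> {axis i 1})"

text \<open>The sum over \<open>i\<close> is a Minkowski sum of sets.\<close>

definition hom_cell :: "('g::finite \<Rightarrow> 'h::finite set) \<Rightarrow> (real ^ 'h ^ 'g) set" where
  "hom_cell \<sigma> = (\<lambda>v. (1 / real CARD('g)) *\<^sub>R v) ` (\<Sum>i\<in>UNIV. axis i ` std_simplex (\<sigma> i))"

definition complete_bipartite :: "('h \<times> 'h) set \<Rightarrow> 'h set \<Rightarrow> 'h set \<Rightarrow> bool" where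
  "complete_bipartite EH A B \<longleftrightarrow> (\<forall>u\<in>A. \<forall>v\<in>B. (u, v) \<in> EH)"

definition Hom_complex ::
    "('g::finite \<times> 'g) set \<Rightarrow> ('h::finite \<times> 'h) set \<Rightarrow> (real ^ 'h ^ 'g) set set" where
  "Hom_complex EG EH = {hom_cell \<sigma> | \<sigma>.
     (\<forall>x. \<sigma> x \<noteq> {}) \<and> (\<forall>x y. (x, y) \<in> EG \<longrightarrow> complete_bipartite EH (\<sigma> x) (\<sigma> y))}"

definition plus_label :: "('g \<times> 'g) set \<Rightarrow> ('h \<times> 'h) set \<Rightarrow> ('g \<Rightarrow> 'h set) \<Rightarrow> bool" where
  "plus_label EG EH \<sigma> \<longleftrightarrow>
     (\<forall>x y. (x, y) \<in> EG \<and> \<sigma> x \<noteq> {} \<and> \<sigma> y \<noteq> {} \<longrightarrow> complete_bipartite EH (\<sigma> x) (\<sigma> y))"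

definition Hom_plus ::
    "('g::finite \<times> 'g) set \<Rightarrow> ('h::finite \<times> 'h) set \<Rightarrow> ((real ^ 'h ^ 'g) \<times> (real ^ 'g)) set set" where
  "Hom_plus EG EH = {join_face \<sigma> | \<sigma>. plus_label EG EH \<sigma>}"

definition Hom_plus_t ::
    "('g::finite \<times> 'g) set \<Rightarrow> ('h::finite \<times> 'h) set \<Rightarrow> ((real ^ 'h ^ 'g) \<times> (real ^ 'g)) set set" where
  "Hom_plus_t EG EH =
     {F. \<exists>\<sigma>. plus_label EG EH \<sigma> \<and> (\<forall>x. card (\<sigma> x) > 0) \<and> F face_of join_face \<sigma>}"

definition one_over_g :: "real ^ 'g::finite" where
  "one_over_g = (\<chi> i. 1 / real CARD('g))"

definition slice :: "((real ^ 'h::finite ^ 'g::finite) \<times> (real ^ 'g)) set" where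
  "slice = UNIV \<times> {one_over_g}"

text \<open>\<open>Hom_slice EG EH\<close> is $\mathrm{Hom}(G,H) \times \frac{\mathbf{1}}{g}$, taken cell by cell.\<close>

definition Hom_slice ::
    "('g::finite \<times> 'g) set \<Rightarrow> ('h::finite \<times> 'h) set \<Rightarrow> ((real ^ 'h ^ 'g) \<times> (real ^ 'g)) set set" where
  "Hom_slice EG EH = (\<lambda>C. C \<times> {one_over_g}) ` Hom_complex EG EH"

definition iota :: "'a set \<Rightarrow> 'a set set \<Rightarrow> 'a set set" where
  "iota K \<P> = (\<lambda>P. P \<inter> K) ` \<P> - {{}}"

definition pi_box ::
    "(real ^ 'h::finite ^ 'g::finite) \<times> (real ^ 'g) \<Rightarrow> (real ^ 'h) \<times> (real ^ 'g)" where
  "pi_box = (\<lambda>(x, y). (\<Sum>i\<in>UNIV. x $ i, y))"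

text \<open>
  The analogue of \<^const>\<open>simplicial_complex\<close> for polytopes.  Closure is only required
  under nonempty faces, since the cells of \<open>Hom_complex\<close> are nonempty.
\<close>

definition polytopal_complex :: "'a::euclidean_space set set \<Rightarrow> bool" where
  "polytopal_complex \<C> \<longleftrightarrow>
     finite \<C> \<and>
     (\<forall>P\<in>\<C>. polytope P) \<and>
     (\<forall>F P. P \<in> \<C> \<and> F face_of P \<and> F \<noteq> {} \<longrightarrow> F \<in> \<C>) \<and>
     (\<forall>P Q. P \<in> \<C> \<and> Q \<in> \<C> \<longrightarrow> (P \<inter> Q) face_of P)"

end

theory Submission
  imports Defs
begin

text \<open>
  The vertices of the join are affinely independent, so its faces are exactly the sets
  \<^term>\<open>join_face \<sigma>\<close>, and any downward closed family of them is a simplicial complex.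
  In a convex combination of points $(\mu_i(t_i), e_i)$ the second component records the weights;
  on the slice all of them equal $1/g$, whence the slice of \<^term>\<open>join_face \<sigma>\<close> is the
  cell \<^term>\<open>hom_cell \<sigma>\<close>, and it is nonempty iff \<open>\<sigma>\<close> is transversal.
  Every face of $S \cap L$, with $L$ affine, is $F \cap L$ for a face $F$ of the polyhedron $S$;
  hence an affine slice of a simplicial complex is a polytopal complex.
  As \<^term>\<open>pi_box\<close> leaves the second component alone, it commutes with slicing.
\<close>

section \<open>Affine independence and simplicial complexes of faces of a simplex\<close>

text \<open>The kernel of \<open>f\<close> is a subspace containing all the other points, hence
  their affine hull, but it misses \<open>x\<close>.\<close>

lemma affine_independent_dual:
  fixes S :: "'a::real_vector set"
  assumes "\<And>x. x \<in> S \<Longrightarrow> \<exists>f. linear f \<and> f x \<noteq> (0::real) \<and> (\<forall>y\<in>S - {x}. f y = 0)"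
  shows "\<not> affine_dependent S"
proof
  assume "affine_dependent S"
  then obtain x where x: "x \<in> S" "x \<in> affine hull (S - {x})"
    by (auto simp: affine_dependent_def)
  obtain f where f: "linear f" "f x \<noteq> (0::real)" "\<forall>y\<in>S - {x}. f y = 0"
    using assms[OF x(1)] by blast
  have "subspace {y. f y = 0}"
    using f(1) by (auto simp: subspace_def linear_0 linear_add linear_scale)
  then have "affine hull (S - {x}) \<subseteq> {y. f y = 0}"
    using f(3) by (intro hull_minimal subspace_imp_affine) auto
  with x f show False by auto
qed

text \<open>Faces of the hull of an affinely independent set are hulls of its subsets: finitely many
  simplices, closed under intersection.\<close>

lemma simplicial_complex_faces_of_simplex:
  fixes C :: "'a::euclidean_space set"
  assumes C: "\<not> affine_dependent C"
    and \<K>: "\<And>S. S \<in> \<K> \<Longrightarrow> S face_of convex hull C"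
    and down: "\<And>S F. \<lbrakk>S \<in> \<K>; F face_of S\<rbrakk> \<Longrightarrow> F \<in> \<K>"
  shows "simplicial_complex \<K>"
  unfolding simplicial_complex_def
proof (intro conjI ballI allI impI; (elim conjE)?)
  have "finite C"
    using C aff_independent_finite by blast
  then have "finite ((hull) convex ` Pow C)"
    by simp
  moreover have *: "\<exists>D\<subseteq>C. S = convex hull D" if "S \<in> \<K>" for S
    using \<K>[OF that] face_of_convex_hull_affine_independent[OF C] by blast
  then have "\<K> \<subseteq> (hull) convex ` Pow C"
    by blast
  ultimately show "finite \<K>"
    by (rule rev_finite_subset)
  show "\<exists>n. n simplex S" if S: "S \<in> \<K>" for S
  proof -
    obtain D where D: "D \<subseteq> C" "S = convex hull D"
      using *[OF S] by blast
    \<comment> \<open>Dimensions are integers, so the empty face counts as a simplex of dimension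
      -1.\<close>
    have "(int (card D) - 1) simplex S"
      unfolding D(2) using C D(1) by (intro simplex_convex_hull) (auto dest: affine_independent_subset)
    then show ?thesis ..
  qed
  show "F \<in> \<K>" if "S \<in> \<K>" "F face_of S" for F S
    using that by (rule down)
  \<comment> \<open>The intersection is a face of the big simplex lying inside \<open>S\<close>,
    hence a face of \<open>S\<close>.\<close>
  show "S \<inter> S' face_of S" if "S \<in> \<K>" "S' \<in> \<K>" for S S'
    using face_of_Int[OF \<K> \<K>, OF that] face_of_imp_subset[OF \<K>[OF that(1)]]
    by (meson face_of_face face_of_subset inf_le1)
qed

section \<open>Faces of affine slices\<close>

text \<open>Take the smallest face containing \<open>x\<close>. The relative interior of a
  polyhedron is what remains after removing its facets, and a facet through \<open>x\<close> would
  be a smaller face.\<close>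

lemma polyhedron_obtain_face_rel_interior:
  fixes S :: "'a::euclidean_space set"
  assumes S: "polyhedron S" and x: "x \<in> S"
  obtains F where "F face_of S" "x \<in> rel_interior F"
proof -
  define F where "F = \<Inter>{F. F face_of S \<and> x \<in> F}"
  \<comment> \<open>The family being intersected is nonempty, since \<open>S\<close> belongs to
    it.\<close>
  have "S face_of S"
    using S by (simp add: face_of_refl polyhedron_imp_convex)
  then have F: "F face_of S"
    unfolding F_def using x by (intro face_of_Inter) auto
  have "polyhedron F"
    using S F by (rule face_of_polyhedron_polyhedron)
  moreover have "x \<in> F"
    by (auto simp: F_def)
  moreover have "x \<notin> G" if G: "G facet_of F" for G
  proof
    assume "x \<in> G"
    have "G face_of S"
      using G F by (meson face_of_trans facet_of_imp_face_of)
    then have "F \<subseteq> G"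
      using \<open>x \<in> G\<close> by (auto simp: F_def)
    moreover have "G \<subseteq> F"
      using G facet_of_imp_subset by blast
    ultimately have "F = G"
      by (rule subset_antisym)
    then show False
      using G facet_of_irrefl[of F] by simp
  qed
  ultimately have "x \<in> rel_interior F"
    by (auto simp: rel_interior_of_polyhedron)
  with F show ?thesis
    by (rule that)
qed

lemma face_of_Int_affineE:
  fixes S :: "'a::euclidean_space set"
  assumes S: "polyhedron S" and L: "affine L" and T: "T face_of S \<inter> L"
  obtains F where "F face_of S" "T = F \<inter> L"
proof (cases "T = {}")
  case True
  then show ?thesis
    using that[of "{}"] by simp
next
  case False
  have "convex T"
    using T by (rule face_of_imp_convex)
  then obtain x where x: "x \<in> rel_interior T"
    using False rel_interior_eq_empty by blast
  have TS: "T \<subseteq> S \<inter> L"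
    using T by (rule face_of_imp_subset)
  have xT: "x \<in> T"
    using x rel_interior_subset by blast
  \<comment> \<open>any \<open>y \<in> F \<inter> L\<close> can be joined to \<open>x\<close> and the segment prolonged inside \<open>F \<inter> L\<close>,
      so that \<open>y \<in> T\<close> because \<open>T\<close> is a face\<close>
  obtain F where F: "F face_of S" "x \<in> rel_interior F"
    using polyhedron_obtain_face_rel_interior[OF S, of x] xT TS by blast
  have FS: "F \<subseteq> S"
    using F(1) by (rule face_of_imp_subset)
  have xF: "x \<in> F"
    using F(2) rel_interior_subset by blast
  \<comment> \<open>A face of \<open>S\<close> that meets the relative interior of \<open>T\<close>,
    here in \<open>x\<close>, contains all of \<open>T\<close>.\<close>
  have "T \<subseteq> F"
    using TS x xF by (intro subset_of_face_of[OF F(1)]) auto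
  moreover have "y \<in> T" if y: "y \<in> F \<inter> L" for y
  proof (cases "y = x")
    case True
    then show ?thesis using xT by simp
  next
    case False
    obtain e where e: "e > 1" "(1 - e) *\<^sub>R y + e *\<^sub>R x \<in> F"
      using convex_rel_interior_iff[of F x] F xF y face_of_imp_convex by blast
    define z where "z = (1 - e) *\<^sub>R y + e *\<^sub>R x"
    have xyz: "x = (1 - 1 / e) *\<^sub>R y + (1 / e) *\<^sub>R z"
    proof -
      \<comment> \<open>This is the total coefficient of \<open>y\<close> after substituting the
        definition of \<open>z\<close>, beyond the term \<open>x\<close>.\<close>
      have "1 - 1 / e + (1 - e) / e = 0"
        using e(1) by (simp add: field_simps)
      then have "(1 - 1 / e) *\<^sub>R y + ((1 - e) / e) *\<^sub>R y = 0"
        by (simp add: scaleR_left_distrib[symmetric])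
      then show ?thesis
        using e(1) by (simp add: z_def scaleR_right_distrib add.assoc[symmetric])
    qed
    have "z \<in> L"
      unfolding z_def using y xT TS L by (auto intro!: mem_affine)
    have "y \<noteq> z"
    proof
      assume "y = z"
      then have "x = y"
        using xyz by (simp add: scaleR_left_distrib[symmetric])
      with \<open>y \<noteq> x\<close> show False by simp
    qed
    then have "x \<in> open_segment y z"
      unfolding in_segment using e(1) xyz by (intro conjI exI[of _ "1 / e"]) auto
    then show ?thesis
      using face_ofD[OF T] y e(2) \<open>z \<in> L\<close> FS xT by (force simp: z_def[symmetric])
  qed
  ultimately show ?thesis
    using that[OF F(1)] TS by blast
qed

text \<open>Closure under faces is the substantial condition: each face of a slice must be the slice
  of a face, and a nonempty one survives the discarding in \<open>iota\<close>. The other conditions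
  pass to slices cell by cell.\<close>

lemma polytopal_complex_iota:
  assumes K: "simplicial_complex \<K>" and L: "affine L"
  shows "polytopal_complex (iota L \<K>)"
  unfolding polytopal_complex_def
proof (intro conjI ballI allI impI; (elim conjE)?)
  have polytope: "polytope S" if "S \<in> \<K>" for S
    using that K simplex_imp_polytope unfolding simplicial_complex_def by blast
  show "finite (iota L \<K>)"
    using K by (simp add: simplicial_complex_def iota_def)
  show "polytope P" if "P \<in> iota L \<K>" for P
    using that L polytope by (auto simp: iota_def intro!: polytope_Int_polyhedron affine_imp_polyhedron)
  show "F \<in> iota L \<K>" if P: "P \<in> iota L \<K>" "F face_of P" "F \<noteq> {}" for F P
  proof -
    obtain S where S: "S \<in> \<K>" "P = S \<inter> L"
      using P(1) by (auto simp: iota_def)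
    obtain G where "G face_of S" "F = G \<inter> L"
      using face_of_Int_affineE[OF polytope_imp_polyhedron[OF polytope[OF S(1)]] L] P(2) S(2)
      by blast
    with P(3) S(1) K show ?thesis
      by (auto simp: iota_def simplicial_complex_def)
  qed
  show "P \<inter> Q face_of P" if PQ: "P \<in> iota L \<K>" "Q \<in> iota L \<K>" for P Q
  proof -
    obtain S S' where S: "S \<in> \<K>" "P = S \<inter> L" "S' \<in> \<K>" "Q = S' \<inter> L"
      using PQ by (auto simp: iota_def)
    have "S \<inter> S' \<inter> L face_of S \<inter> L"
      using K S L by (intro face_of_slice affine_imp_convex) (auto simp: simplicial_complex_def)
    moreover have "P \<inter> Q = S \<inter> S' \<inter> L"
      using S by auto
    ultimately show ?thesis
      using S by simp
  qed
qed

section \<open>The join simplex and its faces\<close>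

text \<open>Vertex \<open>u\<close> of the copy of the simplex labelled \<open>x\<close>. Indexing
  by pairs turns a label into a set of vertices, \<open>Sigma UNIV \<sigma>\<close>.\<close>

definition join_vertex :: "'g::finite \<times> 'h::finite \<Rightarrow> (real ^ 'h ^ 'g) \<times> (real ^ 'g)" where
  "join_vertex = (\<lambda>(x, u). (axis x (axis u 1), axis x 1))"

lemma linear_axis: "linear (axis i)"
  by (rule linearI) (auto simp: vec_eq_iff axis_def)

lemma axis_std_simplex_times:
  "axis i ` std_simplex B \<times> {axis i 1} = convex hull (join_vertex ` ({i} \<times> B))"
proof -
  have "axis i ` std_simplex B \<times> {axis i (1::real)}
      = (convex hull ((\<lambda>u. axis i (axis u 1)) ` B)) \<times> (convex hull {axis i 1})"
    by (simp add: std_simplex_def convex_hull_linear_image[OF linear_axis] image_image)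
  also have "\<dots> = convex hull (join_vertex ` ({i} \<times> B))"
    unfolding convex_hull_Times[symmetric]
    by (rule arg_cong[where f = "(hull) convex"]) (auto simp: join_vertex_def)
  finally show ?thesis .
qed

text \<open>The hull of a union of hulls collapses to a single hull of vertices, to which the theory
  of affinely independent sets applies.\<close>

lemma join_face_eq: "join_face \<sigma> = convex hull (join_vertex ` Sigma UNIV \<sigma>)"
proof
  show "join_face \<sigma> \<subseteq> convex hull (join_vertex ` Sigma UNIV \<sigma>)"
    unfolding join_face_def axis_std_simplex_times
    by (intro hull_minimal UN_least hull_mono convex_convex_hull image_mono) auto
  show "convex hull (join_vertex ` Sigma UNIV \<sigma>) \<subseteq> join_face \<sigma>"
    unfolding join_face_def axis_std_simplex_times
    by (intro hull_mono) (auto intro!: hull_inc)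
qed

lemma affine_independent_join_vertices: "\<not> affine_dependent (range join_vertex)"
proof (rule affine_independent_dual)
  fix v :: "(real ^ 'h ^ 'g) \<times> (real ^ 'g)"
  assume "v \<in> range join_vertex"
  then obtain x u where v: "v = join_vertex (x, u)"
    by auto
  \<comment> \<open>The coordinate \<open>(x, u)\<close> of the first component is 1 at its own
    vertex and 0 at all others.\<close>
  have "linear (\<lambda>z::(real ^ 'h ^ 'g) \<times> (real ^ 'g). fst z $ x $ u)"
    by (rule linearI) auto
  then show "\<exists>f. linear f \<and> f v \<noteq> (0::real) \<and> (\<forall>y\<in>range join_vertex - {v}. f y = 0)"
    by (rule_tac exI, rule_tac conjI) (auto simp: v join_vertex_def axis_def split: if_split_asm)
qed

lemma affine_independent_axes: "\<not> affine_dependent (range (\<lambda>i. axis i 1 :: real ^ 'n::finite))"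
proof (rule affine_independent_dual)
  fix v :: "real ^ 'n"
  assume "v \<in> range (\<lambda>i. axis i 1)"
  then obtain i where v: "v = axis i 1"
    by auto
  have "linear (\<lambda>z::real ^ 'n. z $ i)"
    by (rule linearI) auto
  then show "\<exists>f. linear f \<and> f v \<noteq> (0::real) \<and> (\<forall>y\<in>range (\<lambda>i. axis i 1) - {v}. f y = 0)"
    by (rule_tac exI, rule_tac conjI) (auto simp: v axis_def split: if_split_asm)
qed

lemma face_of_join_face_iff: "F face_of join_face \<sigma> \<longleftrightarrow> (\<exists>\<tau>. (\<forall>x. \<tau> x \<subseteq> \<sigma> x) \<and> F = join_face \<tau>)"
proof -
  have "\<not> affine_dependent (join_vertex ` Sigma UNIV \<sigma>)"
    using affine_independent_join_vertices by (rule affine_independent_subset) auto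
  then have "F face_of join_face \<sigma>
      \<longleftrightarrow> (\<exists>D\<subseteq>Sigma UNIV \<sigma>. F = convex hull (join_vertex ` D))"
    unfolding join_face_eq by (auto simp: face_of_convex_hull_affine_independent subset_image_iff)
  also have "\<dots> \<longleftrightarrow> (\<exists>\<tau>. (\<forall>x. \<tau> x \<subseteq> \<sigma> x) \<and> F = join_face \<tau>)"
  proof
    assume "\<exists>D\<subseteq>Sigma UNIV \<sigma>. F = convex hull (join_vertex ` D)"
    then obtain D where D: "D \<subseteq> Sigma UNIV \<sigma>" "F = convex hull (join_vertex ` D)"
      by blast
    have "D = (SIGMA x:UNIV. D `` {x})"
      by auto
    with D have "F = join_face (\<lambda>x. D `` {x})"
      by (simp add: join_face_eq)
    with D(1) show "\<exists>\<tau>. (\<forall>x. \<tau> x \<subseteq> \<sigma> x) \<and> F = join_face \<tau>"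
      by (intro exI[of _ "\<lambda>x. D `` {x}"]) auto
  next
    assume "\<exists>\<tau>. (\<forall>x. \<tau> x \<subseteq> \<sigma> x) \<and> F = join_face \<tau>"
    then obtain \<tau> where "\<forall>x. \<tau> x \<subseteq> \<sigma> x" "F = join_face \<tau>"
      by blast
    then show "\<exists>D\<subseteq>Sigma UNIV \<sigma>. F = convex hull (join_vertex ` D)"
      by (intro exI[of _ "Sigma UNIV \<tau>"]) (auto simp: join_face_eq)
  qed
  finally show ?thesis .
qed

section \<open>Slicing a face of the join\<close>

text \<open>Unfolds the Minkowski sum into one chosen point per block, ready for comparison with
  convex combinations in the join.\<close>

lemma hom_cell_altdef:
  "hom_cell \<sigma> = {(1 / real CARD('g)) *\<^sub>R (\<Sum>i\<in>UNIV. axis i (t i)) | t. \<forall>i::'g::finite. t i \<in> std_simplex (\<sigma> i)}"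
  (is "?l = ?r")
proof
  show "?l \<subseteq> ?r"
  proof
    fix v assume "v \<in> ?l"
    then obtain s where s: "\<forall>i. s i \<in> axis i ` std_simplex (\<sigma> i)"
        "v = (1 / real CARD('g)) *\<^sub>R (\<Sum>i\<in>UNIV. s i)"
      by (auto simp: hom_cell_def set_sum_alt)
    then have "\<forall>i. \<exists>t. t \<in> std_simplex (\<sigma> i) \<and> s i = axis i t"
      by blast
    then obtain t where "\<forall>i. t i \<in> std_simplex (\<sigma> i) \<and> s i = axis i (t i)"
      by metis
    with s(2) show "v \<in> ?r" by auto
  qed
  show "?r \<subseteq> ?l"
    by (fastforce simp: hom_cell_def set_sum_alt)
qed

lemma std_simplex_eq_empty_iff: "std_simplex B = {} \<longleftrightarrow> B = {}"
  by (simp add: std_simplex_def)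

lemma hom_cell_eq_empty_iff: "hom_cell \<sigma> = {} \<longleftrightarrow> (\<exists>x. \<sigma> x = {})"
proof -
  have "hom_cell \<sigma> \<noteq> {} \<longleftrightarrow> (\<exists>t. \<forall>i. t i \<in> std_simplex (\<sigma> i))"
    by (auto simp: hom_cell_altdef)
  also have "\<dots> \<longleftrightarrow> (\<forall>i. std_simplex (\<sigma> i) \<noteq> {})"
    using choice[of "\<lambda>i t. t \<in> std_simplex (\<sigma> i)"] by blast
  finally show ?thesis
    by (auto simp: std_simplex_eq_empty_iff)
qed

text \<open>Reads the weights of a convex combination off its second component.\<close>

lemma sum_scaleR_axis_nth: "(\<Sum>i\<in>UNIV. c i *\<^sub>R axis i (1::real)) $ (j::'g::finite) = c j"
  by (simp add: axis_def if_distrib cong: if_cong)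

lemma join_face_Int_slice:
  fixes \<sigma> :: "'g::finite \<Rightarrow> 'h::finite set"
  shows "join_face \<sigma> \<inter> slice = hom_cell \<sigma> \<times> {one_over_g}"
proof
  show "hom_cell \<sigma> \<times> {one_over_g} \<subseteq> join_face \<sigma> \<inter> slice"
  proof clarify
    fix v assume "v \<in> hom_cell \<sigma>"
    then obtain t where t: "\<forall>i. t i \<in> std_simplex (\<sigma> i)"
        "v = (1 / real CARD('g)) *\<^sub>R (\<Sum>i\<in>UNIV. axis i (t i))"
      by (auto simp: hom_cell_altdef)
    \<comment> \<open>Equal weights exhibit the point as a convex combination of one point from each
      block.\<close>
    have "one_over_g = (\<Sum>i\<in>UNIV. (1 / real CARD('g)) *\<^sub>R axis i (1::real) :: real ^ 'g)"
      unfolding vec_eq_iff sum_scaleR_axis_nth by (simp add: one_over_g_def)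
    then have "(v, one_over_g) = (\<Sum>i\<in>UNIV. (1 / real CARD('g)) *\<^sub>R (axis i (t i), axis i 1))"
      using t(2) by (simp add: sum_prod scaleR_sum_right)
    also have "\<dots> \<in> join_face \<sigma>"
      unfolding join_face_def using t(1) by (intro convex_sum) (auto intro!: hull_inc)
    finally show "(v, one_over_g) \<in> join_face \<sigma> \<inter> slice"
      by (simp add: slice_def)
  qed
  show "join_face \<sigma> \<inter> slice \<subseteq> hom_cell \<sigma> \<times> {one_over_g}"
  proof
    fix z assume z: "z \<in> join_face \<sigma> \<inter> slice"
    then have z2: "snd z = one_over_g"
      by (auto simp: slice_def)
    \<comment> \<open>Without vertices in block \<open>i\<close>, the \<open>i\<close>-th weight
      would vanish on the whole face, whereas on the slice it is \<open>1/g\<close>. Nonempty blocks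
      are what the description of the hull of a finite union below requires.\<close>
    have ne: "\<sigma> i \<noteq> {}" for i
    proof
      assume "\<sigma> i = {}"
      have "subspace {z::(real ^ 'h ^ 'g) \<times> (real ^ 'g). snd z $ i = 0}"
        by (auto simp: subspace_def)
      then have "join_face \<sigma> \<subseteq> {z. snd z $ i = 0}"
        unfolding join_face_eq using \<open>\<sigma> i = {}\<close>
        by (intro hull_minimal subspace_imp_convex) (auto simp: join_vertex_def axis_def)
      with z z2 show False
        by (auto simp: one_over_g_def)
    qed
    have "join_face \<sigma> = {\<Sum>i\<in>UNIV. c i *\<^sub>R s i | c s. (\<forall>i\<in>UNIV. c i \<ge> 0) \<and> sum c UNIV = 1
          \<and> (\<forall>i\<in>UNIV. s i \<in> axis i ` std_simplex (\<sigma> i) \<times> {axis i 1})}"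
      unfolding join_face_def
      by (rule convex_hull_finite_union) (auto simp: axis_std_simplex_times ne)
    with z obtain c s where cs: "z = (\<Sum>i\<in>UNIV. c i *\<^sub>R s i)"
        "\<forall>i. s i \<in> axis i ` std_simplex (\<sigma> i) \<times> {axis i 1}"
      by auto
    from cs(2) have "\<forall>i. \<exists>t. t \<in> std_simplex (\<sigma> i) \<and> s i = (axis i t, axis i 1)"
      by blast
    then obtain t where t: "\<forall>i. t i \<in> std_simplex (\<sigma> i) \<and> s i = (axis i (t i), axis i 1)"
      by metis
    \<comment> \<open>The second component of \<open>z\<close> is the vector of weights
      \<open>c\<close>, and on the slice it is \<open>one_over_g\<close>.\<close>
    have "c j = 1 / real CARD('g)" for j
      using z2 t cs(1) sum_scaleR_axis_nth[of c j]
      by (simp add: snd_sum one_over_g_def)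
    then have "fst z = (1 / real CARD('g)) *\<^sub>R (\<Sum>i\<in>UNIV. axis i (t i))"
      using t cs(1) by (simp add: fst_sum scaleR_sum_right)
    then have "fst z \<in> hom_cell \<sigma>"
      using t by (auto simp: hom_cell_altdef)
    with z2 show "z \<in> hom_cell \<sigma> \<times> {one_over_g}"
      by (cases z) auto
  qed
qed

section \<open>The projection \<open>pi_box\<close>\<close>

lemma linear_pi_box: "linear pi_box"
  by (rule linearI) (auto simp: pi_box_def sum.distrib scaleR_sum_right)

lemma pi_box_join_vertex: "pi_box (join_vertex (x, u)) = (axis u 1, axis x 1)"
proof -
  have "(\<Sum>i\<in>UNIV. axis x (axis u (1::real)) $ i) = axis u 1"
    by (simp add: axis_def)
  then show ?thesis
    by (simp add: pi_box_def join_vertex_def)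
qed

text \<open>A linear map sends hulls to hulls, and here each vertex of the join goes to a vertex of
  the product of simplices.\<close>

lemma pi_box_join_face:
  "pi_box ` join_face \<sigma> = convex hull ((\<lambda>(x, u). (axis u 1, axis x 1)) ` Sigma UNIV \<sigma>)"
proof -
  have "pi_box ` join_face \<sigma> = convex hull (pi_box ` join_vertex ` Sigma UNIV \<sigma>)"
    unfolding join_face_eq by (rule convex_hull_linear_image[OF linear_pi_box])
  also have "pi_box ` join_vertex ` Sigma UNIV \<sigma> = (\<lambda>(x, u). (axis u 1, axis x 1)) ` Sigma UNIV \<sigma>"
    unfolding image_image by (rule image_cong) (auto simp: pi_box_join_vertex)
  finally show ?thesis .
qed

text \<open>Images commute with this intersection because membership in \<open>slice\<close> depends
  only on the second component, which \<open>pi_box\<close> preserves.\<close>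

lemma pi_box_image_Int_slice: "pi_box ` (S \<inter> slice) = pi_box ` S \<inter> pi_box ` slice"
proof
  show "pi_box ` S \<inter> pi_box ` slice \<subseteq> pi_box ` (S \<inter> slice)"
  proof
    fix p assume "p \<in> pi_box ` S \<inter> pi_box ` slice"
    then obtain s t where st: "s \<in> S" "p = pi_box s" "t \<in> slice" "p = pi_box t"
      by blast
    then have "snd s = snd t"
      by (simp add: pi_box_def split_beta)
    then have "s \<in> slice"
      using st(3) by (cases s, cases t) (simp add: slice_def)
    with st(1,2) show "p \<in> pi_box ` (S \<inter> slice)"
      by blast
  qed
qed blast

lemma axis_extreme_point_of_std_simplex: "axis i 1 extreme_point_of std_simplex UNIV"
  unfolding std_simplex_def
  by (simp add: extreme_point_of_convex_hull_affine_independent[OF affine_independent_axes])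

text \<open>A product of faces is a face of the product; apply this to singletons.\<close>

lemma axes_extreme_point_of_Times:
  "(axis u 1, axis x 1) extreme_point_of std_simplex UNIV \<times> std_simplex UNIV"
  using face_of_Times[of "{axis u (1::real)}" "std_simplex UNIV" "{axis x (1::real)}" "std_simplex UNIV"]
  by (simp add: face_of_singleton axis_extreme_point_of_std_simplex)

lemma pi_box_join_face_subset: "pi_box ` join_face \<sigma> \<subseteq> std_simplex UNIV \<times> std_simplex UNIV"
  unfolding pi_box_join_face std_simplex_def convex_hull_Times[symmetric]
  by (rule hull_mono) auto

lemma fst_join_face_subset: "fst ` join_face \<sigma> \<subseteq> block_simplex"
  unfolding join_face_eq block_simplex_def convex_hull_linear_image[OF linear_fst]
  by (rule hull_mono) (force simp: join_vertex_def)

lemma affine_slice: "affine slice"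
  by (auto simp: affine_def slice_def scaleR_left_distrib[symmetric])

section \<open>The two complexes of join faces\<close>

lemma Hom_plus_t_iff:
  "F \<in> Hom_plus_t EG EH \<longleftrightarrow>
    (\<exists>\<sigma> \<tau>. plus_label EG EH \<sigma> \<and> (\<forall>x. \<sigma> x \<noteq> {}) \<and> (\<forall>x. \<tau> x \<subseteq> \<sigma> x) \<and> F = join_face \<tau>)"
  by (auto simp: Hom_plus_t_def face_of_join_face_iff card_gt_0_iff)

text \<open>The source of face closure for \<open>Hom_plus\<close>, and of its containing
  \<open>Hom_plus_t\<close>.\<close>

lemma plus_label_mono: "\<lbrakk>plus_label EG EH \<sigma>; \<forall>x. \<tau> x \<subseteq> \<sigma> x\<rbrakk> \<Longrightarrow> plus_label EG EH \<tau>"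
  unfolding plus_label_def complete_bipartite_def by blast

lemma Hom_plus_t_subset: "Hom_plus_t EG EH \<subseteq> Hom_plus EG EH"
  unfolding Hom_plus_t_iff Hom_plus_def subset_iff using plus_label_mono by blast

lemma Hom_plus_face_closed:
  assumes "S \<in> Hom_plus EG EH" "F face_of S"
  shows "F \<in> Hom_plus EG EH"
proof -
  obtain \<sigma> where \<sigma>: "S = join_face \<sigma>" "plus_label EG EH \<sigma>"
    using assms(1) by (auto simp: Hom_plus_def)
  obtain \<tau> where \<tau>: "\<forall>x. \<tau> x \<subseteq> \<sigma> x" "F = join_face \<tau>"
    using assms(2) unfolding \<sigma>(1) face_of_join_face_iff by blast
  have "plus_label EG EH \<tau>"
    using \<sigma>(2) \<tau>(1) by (rule plus_label_mono)
  with \<tau>(2) show ?thesis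
    by (auto simp: Hom_plus_def)
qed

lemma Hom_plus_t_face_closed: "\<lbrakk>S \<in> Hom_plus_t EG EH; F face_of S\<rbrakk> \<Longrightarrow> F \<in> Hom_plus_t EG EH"
  unfolding Hom_plus_t_def using face_of_trans by blast

lemma Hom_plus_face_of: "S \<in> Hom_plus EG EH \<Longrightarrow> S face_of join_face (\<lambda>_. UNIV)"
  by (auto simp: Hom_plus_def face_of_join_face_iff)

lemma
  shows simplicial_complex_Hom_plus: "simplicial_complex (Hom_plus EG EH)"
    and simplicial_complex_Hom_plus_t: "simplicial_complex (Hom_plus_t EG EH)"
proof -
  have join: "join_face (\<lambda>_. UNIV) = convex hull (range join_vertex)"
    by (simp add: join_face_eq)
  show "simplicial_complex (Hom_plus EG EH)"
    by (rule simplicial_complex_faces_of_simplex[OF affine_independent_join_vertices])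
      (auto simp: join[symmetric] intro: Hom_plus_face_of Hom_plus_face_closed)
  show "simplicial_complex (Hom_plus_t EG EH)"
    by (rule simplicial_complex_faces_of_simplex[OF affine_independent_join_vertices])
      (use Hom_plus_t_subset in \<open>auto simp: join[symmetric] intro: Hom_plus_face_of Hom_plus_t_face_closed\<close>)
qed

section \<open>Slices of the two complexes\<close>

text \<open>Only transversal faces meet the slice, so every family between the transversal faces and
  \<open>Hom_plus\<close> has the same slices. This treats both complexes at once.\<close>

lemma iota_slice_eqI:
  assumes "{join_face \<sigma> |\<sigma>. plus_label EG EH \<sigma> \<and> (\<forall>x. \<sigma> x \<noteq> {})} \<subseteq> \<K>" "\<K> \<subseteq> Hom_plus EG EH"
  shows "iota slice \<K> = Hom_slice EG EH"
proof
  show "iota slice \<K> \<subseteq> Hom_slice EG EH"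
  proof
    fix P assume "P \<in> iota slice \<K>"
    then obtain S where S: "S \<in> \<K>" "P = S \<inter> slice" "P \<noteq> {}"
      by (auto simp: iota_def)
    obtain \<sigma> where \<sigma>: "plus_label EG EH \<sigma>" "S = join_face \<sigma>"
      using S(1) assms(2) by (auto simp: Hom_plus_def)
    have P: "P = hom_cell \<sigma> \<times> {one_over_g}"
      unfolding S(2) \<sigma>(2) by (rule join_face_Int_slice)
    then have "\<forall>x. \<sigma> x \<noteq> {}"
      using S(3) hom_cell_eq_empty_iff[of \<sigma>] by auto
    with \<sigma>(1) P show "P \<in> Hom_slice EG EH"
      by (auto simp: Hom_slice_def Hom_complex_def plus_label_def)
  qed
  show "Hom_slice EG EH \<subseteq> iota slice \<K>"
  proof
    fix P assume "P \<in> Hom_slice EG EH"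
    then obtain \<sigma> where \<sigma>: "P = hom_cell \<sigma> \<times> {one_over_g}" "\<forall>x. \<sigma> x \<noteq> {}"
        "\<forall>x y. (x, y) \<in> EG \<longrightarrow> complete_bipartite EH (\<sigma> x) (\<sigma> y)"
      by (auto simp: Hom_slice_def Hom_complex_def)
    then have "plus_label EG EH \<sigma>"
      by (simp add: plus_label_def)
    then have "join_face \<sigma> \<in> \<K>"
      using assms(1) \<sigma>(2) by blast
    moreover have "P \<noteq> {}"
      using \<sigma>(1,2) by (auto simp: hom_cell_eq_empty_iff)
    ultimately show "P \<in> iota slice \<K>"
      unfolding iota_def \<sigma>(1) join_face_Int_slice[symmetric] by blast
  qed
qed

lemma iota_slice_Hom_plus: "iota slice (Hom_plus EG EH) = Hom_slice EG EH"
  by (rule iota_slice_eqI) (auto simp: Hom_plus_def)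

lemma iota_slice_Hom_plus_t: "iota slice (Hom_plus_t EG EH) = Hom_slice EG EH"
  by (rule iota_slice_eqI[OF _ Hom_plus_t_subset]) (fastforce simp: Hom_plus_t_iff)

section \<open>The commuting square\<close>

lemma image_iota_commute:
  assumes "\<And>S. S \<in> \<K> \<Longrightarrow> f ` (S \<inter> K) = f ` S \<inter> f ` K"
  shows "(`) f ` iota K \<K> = iota (f ` K) ((`) f ` \<K>)"
proof -
  \<comment> \<open>An image is empty only if the set is, so discarding empty sets may be done
    before or after \<open>f\<close>.\<close>
  have "(`) f ` iota K \<K> = (\<lambda>S. f ` (S \<inter> K)) ` \<K> - {{}}"
    unfolding iota_def by blast
  also have "(\<lambda>S. f ` (S \<inter> K)) ` \<K> = (\<lambda>S. f ` S \<inter> f ` K) ` \<K>"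
    using assms by (rule image_cong[OF refl])
  finally show ?thesis
    by (simp add: iota_def image_image)
qed

lemma iotaI: "\<lbrakk>S \<in> \<K>; S \<inter> K \<noteq> {}\<rbrakk> \<Longrightarrow> S \<inter> K \<in> iota K \<K>"
  by (auto simp: iota_def)

theorem theorem2p7:
  fixes EG :: "('g::finite \<times> 'g) set" and EH :: "('h::finite \<times> 'h) set"
  assumes "sym EG" and "sym EH"
  shows
    "iota slice (Hom_plus_t EG EH) = iota slice (Hom_plus EG EH)
     \<and> iota slice (Hom_plus EG EH) = Hom_slice EG EH
     \<and> simplicial_complex (Hom_plus EG EH)
     \<and> simplicial_complex (Hom_plus_t EG EH)
     \<and> polytopal_complex (Hom_slice EG EH)
     \<and> (\<forall>\<K> \<in> {Hom_plus EG EH, Hom_plus_t EG EH}.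
       (\<forall>S\<in>\<K>.
          (S \<inter> slice \<noteq> {} \<longrightarrow> S \<inter> slice \<in> Hom_slice EG EH)
        \<and> (pi_box ` S \<inter> pi_box ` slice \<noteq> {} \<longrightarrow>
             pi_box ` S \<inter> pi_box ` slice \<in> (`) pi_box ` Hom_slice EG EH)
        \<and> pi_box ` (S \<inter> slice) = pi_box ` S \<inter> pi_box ` slice)
     \<and> (\<forall>S\<in>\<K>. S face_of join_face (\<lambda>_. UNIV))
     \<and> (\<forall>S\<in>Hom_slice EG EH. S \<subseteq> block_simplex \<times> {one_over_g})
     \<and> (\<forall>S\<in>\<K>. pi_box ` S \<subseteq> std_simplex UNIV \<times> std_simplex UNIV)
     \<and> (\<forall>S\<in>Hom_slice EG EH. pi_box ` S \<subseteq> std_simplex UNIV \<times> {one_over_g})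
     \<and> (\<forall>S\<in>\<K>. \<exists>W. W \<subseteq> {v. v extreme_point_of (std_simplex UNIV \<times> std_simplex UNIV)}
                  \<and> pi_box ` S = convex hull W)
     \<and> (`) pi_box ` Hom_slice EG EH = iota (pi_box ` slice) ((`) pi_box ` \<K>))"
proof -
  have iota: "iota slice \<K> = Hom_slice EG EH" if "\<K> \<in> {Hom_plus EG EH, Hom_plus_t EG EH}" for \<K>
    using that by (auto simp: iota_slice_Hom_plus iota_slice_Hom_plus_t)
  have slices: "S \<inter> slice \<in> Hom_slice EG EH"
    if "\<K> \<in> {Hom_plus EG EH, Hom_plus_t EG EH}" "S \<in> \<K>" "S \<inter> slice \<noteq> {}" for \<K> S
    using iotaI[OF that(2,3)] unfolding iota[OF that(1)] .
  have sub: "S \<in> Hom_plus EG EH" if "\<K> \<in> {Hom_plus EG EH, Hom_plus_t EG EH}" "S \<in> \<K>" for \<K> S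
    using that(1)
  proof (elim insertE emptyE)
    assume "\<K> = Hom_plus_t EG EH"
    then show ?thesis
      using that(2) Hom_plus_t_subset by blast
  qed (use that(2) in simp)
  have plus: "\<exists>\<sigma>. S = join_face \<sigma>" if "S \<in> Hom_plus EG EH" for S
    using that by (auto simp: Hom_plus_def)
  \<comment> \<open>Cells are slices of join faces, so the bounds on cells follow from those on join
    faces.\<close>
  have cell: "\<exists>T\<in>Hom_plus EG EH. S = T \<inter> slice" if "S \<in> Hom_slice EG EH" for S
    using that unfolding iota_slice_Hom_plus[symmetric] by (auto simp: iota_def)
  show ?thesis
  proof (intro conjI ballI impI)
    show "iota slice (Hom_plus_t EG EH) = iota slice (Hom_plus EG EH)"
      by (simp add: iota_slice_Hom_plus iota_slice_Hom_plus_t)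
    show "iota slice (Hom_plus EG EH) = Hom_slice EG EH"
      by (rule iota_slice_Hom_plus)
    show "simplicial_complex (Hom_plus EG EH)" "simplicial_complex (Hom_plus_t EG EH)"
      by (rule simplicial_complex_Hom_plus simplicial_complex_Hom_plus_t)+
    show "polytopal_complex (Hom_slice EG EH)"
      using polytopal_complex_iota[OF simplicial_complex_Hom_plus affine_slice]
      by (simp add: iota_slice_Hom_plus)
    show "S \<subseteq> block_simplex \<times> {one_over_g}" if S: "S \<in> Hom_slice EG EH" for S
    proof -
      obtain \<sigma> where "S = join_face \<sigma> \<inter> slice"
        using cell[OF S] plus by blast
      then show ?thesis
        using fst_join_face_subset[of \<sigma>] by (force simp: slice_def)
    qed
    show "pi_box ` S \<subseteq> std_simplex UNIV \<times> {one_over_g}" if S: "S \<in> Hom_slice EG EH" for S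
    proof -
      obtain \<sigma> where "S = join_face \<sigma> \<inter> slice"
        using cell[OF S] plus by blast
      then have "pi_box ` S \<subseteq> std_simplex UNIV \<times> std_simplex UNIV" "S \<subseteq> slice"
        using pi_box_join_face_subset[of \<sigma>] by auto
      then show ?thesis
        by (force simp: slice_def pi_box_def)
    qed
    fix \<K> assume \<K>: "\<K> \<in> {Hom_plus EG EH, Hom_plus_t EG EH}"
    show "(`) pi_box ` Hom_slice EG EH = iota (pi_box ` slice) ((`) pi_box ` \<K>)"
      unfolding iota[OF \<K>, symmetric]
      by (intro image_iota_commute pi_box_image_Int_slice)
    fix S assume S: "S \<in> \<K>"
    obtain \<sigma> where \<sigma>: "S = join_face \<sigma>"
      using plus[OF sub[OF \<K> S]] by blast
    show "S \<inter> slice \<in> Hom_slice EG EH" if "S \<inter> slice \<noteq> {}"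
      using slices[OF \<K> S that] .
    show "pi_box ` S \<inter> pi_box ` slice \<in> (`) pi_box ` Hom_slice EG EH"
      if "pi_box ` S \<inter> pi_box ` slice \<noteq> {}"
      using that slices[OF \<K> S] unfolding pi_box_image_Int_slice[symmetric] by blast
    show "pi_box ` (S \<inter> slice) = pi_box ` S \<inter> pi_box ` slice"
      by (rule pi_box_image_Int_slice)
    show "S face_of join_face (\<lambda>_. UNIV)"
      using sub[OF \<K> S] by (rule Hom_plus_face_of)
    show "pi_box ` S \<subseteq> std_simplex UNIV \<times> std_simplex UNIV"
      unfolding \<sigma> by (rule pi_box_join_face_subset)
    show "\<exists>W. W \<subseteq> {v. v extreme_point_of (std_simplex UNIV \<times> std_simplex UNIV)}
        \<and> pi_box ` S = convex hull W"
      \<comment> \<open>\<open>W\<close> is the set of pairs \<open>(axis u 1, axis x 1)\<close>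
        with \<open>u \<in> \<sigma> x\<close>; solving the second conjunct by reflexivity fixes
        it.\<close>
      unfolding \<sigma> pi_box_join_face using axes_extreme_point_of_Times
      by (intro exI conjI) (rule_tac [2] refl, auto)
  qed
qed

end
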